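(* The problem Forget is undecidable.
   Context: Temporal Datalog. Constants are partitioned into objects and integer time points; variables into object variables and time variables. A time term is a time point, a time variable, or an expression $t+k$ with $t$ a time variable and $k\in\mathbb{Z}$. Each predicate is either extensional (EDB) or intensional (IDB) and has an arity $n\ge0$, each position being of object sort or time sort; a predicate is rigid if all its positions are of object sort, and temporal if its last position is of time sort and all others are of object sort. An atom $P(t_1,\dots,t_n)$ has terms of the required sorts. A rule is $\bigwedge_i\alpha_i\to\alpha$ with $\alpha$ and all $\alpha_i$ rigid or temporal atoms, $\alpha$ IDB whenever the body is nonempty, and every head variable occurring in the body. A program is a finite set of rules. A fact is a ground rigid or temporal atom without $+$ (identified with the rule $\top\to\alpha$); a dataset is a finite set of EDB facts. Rules are read as universally quantified first-order sentences with $+$ interpreted as integer addition; $\Pi\models\alpha$ denotes entailment. A query is $Q=\langle P_Q,\Pi_Q\rangle$ with $\Pi_Q$ a program and $P_Q$ an IDB predicate of $\Pi_Q$; it is temporal if $P_Q$ is temporal. For a temporal query $Q$, dataset $D$ and time point $\tau$, $Q(D,\tau)$ is the set of tuples of objects $\vec o$ with $\Pi_Q\cup D\models P_Q(\vec o,\tau)$. For a dataset $D$ and time point $\tau$, $D[\tau]$ is the set of all rigid facts of $D$ together with the temporal facts of $D$ whose time argument is $>\tau$. A $\tau_{in}$-history is a dataset consisting of rigid facts and temporal facts with time argument $\le\tau_{in}$; a $\tau_{in}$-update is a dataset consisting of temporal facts with time argument $>\tau_{in}$. Forget: an instance is $\langle Q,D,\tau_{in},\tau_{out},\tau_{mem}\rangle$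 with $Q$ a temporal query, $D$ a $\tau_{in}$-history and $\tau_{mem}\le\tau_{out}\le\tau_{in}$; Forget holds for it iff $Q(D\cup U,\tau)=Q(D[\tau_{mem}]\cup U,\tau)$ for every $\tau_{in}$-update $U$ and every time point $\tau\ge\tau_{out}$. *)

theory Defs
  imports Main "HOL-Library.Nat_Bijection"
begin

text \<open>Objects are named by natural numbers, time points are integers.
  Object variables and time variables are named by natural numbers
  (two disjoint namespaces).\<close>

datatype sort = ObjS | TimeS

datatype pred = Pred (pname: nat) (is_edb: bool) (psorts: "sort list")

datatype tm =
    OConst nat
  | OVar nat
  | TConst int
  | TVar nat
  | TPlus nat int

fun term_sort :: "tm \<Rightarrow> sort" where
  "term_sort (OConst _) = ObjS"
| "term_sort (OVar _) = ObjS"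
| "term_sort (TConst _) = TimeS"
| "term_sort (TVar _) = TimeS"
| "term_sort (TPlus _ _) = TimeS"

fun term_ground :: "tm \<Rightarrow> bool" where
  "term_ground (OConst _) = True"
| "term_ground (TConst _) = True"
| "term_ground _ = False"

fun term_vars :: "tm \<Rightarrow> (nat + nat) set" where
  "term_vars (OVar x) = {Inl x}"
| "term_vars (TVar t) = {Inr t}"
| "term_vars (TPlus t _) = {Inr t}"
| "term_vars _ = {}"

datatype atom = Atom (apred: pred) (aargs: "tm list")

datatype rule = Rule (body: "atom list") (head: atom)

definition rigid_pred :: "pred \<Rightarrow> bool" where
  "rigid_pred P \<longleftrightarrow> (\<forall>s\<in>set (psorts P). s = ObjS)"

definition temporal_pred :: "pred \<Rightarrow> bool" where
  "temporal_pred P \<longleftrightarrow> psorts P \<noteq> [] \<and> last (psorts P) = TimeS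
      \<and> (\<forall>s\<in>set (butlast (psorts P)). s = ObjS)"

definition well_sorted :: "atom \<Rightarrow> bool" where
  "well_sorted a \<longleftrightarrow> map term_sort (aargs a) = psorts (apred a)"

definition rigid_atom :: "atom \<Rightarrow> bool" where
  "rigid_atom a \<longleftrightarrow> well_sorted a \<and> rigid_pred (apred a)"

definition temporal_atom :: "atom \<Rightarrow> bool" where
  "temporal_atom a \<longleftrightarrow> well_sorted a \<and> temporal_pred (apred a)"

definition atom_vars :: "atom \<Rightarrow> (nat + nat) set" where
  "atom_vars a = (\<Union>t\<in>set (aargs a). term_vars t)"

definition ground_atom :: "atom \<Rightarrow> bool" where
  "ground_atom a \<longleftrightarrow> (\<forall>t\<in>set (aargs a). term_ground t)"

definition wf_rule :: "rule \<Rightarrow> bool" where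
  "wf_rule r \<longleftrightarrow>
     (\<forall>a\<in>set (head r # body r). rigid_atom a \<or> temporal_atom a)
     \<and> (body r \<noteq> [] \<longrightarrow> \<not> is_edb (apred (head r)))
     \<and> atom_vars (head r) \<subseteq> (\<Union>a\<in>set (body r). atom_vars a)"

text \<open>A program is a finite set of rules; we represent it by a list.\<close>
definition wf_program :: "rule list \<Rightarrow> bool" where
  "wf_program \<Pi> \<longleftrightarrow> (\<forall>r\<in>set \<Pi>. wf_rule r)"

text \<open>A fact is a ground rigid or temporal atom (ground atoms never
  contain +, since + is only applied to time variables).\<close>
definition is_fact :: "atom \<Rightarrow> bool" where
  "is_fact a \<longleftrightarrow> ground_atom a \<and> (rigid_atom a \<or> temporal_atom a)"

text \<open>A dataset is a finite set of EDB facts; represented by a list.\<close>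
definition is_dataset :: "atom list \<Rightarrow> bool" where
  "is_dataset D \<longleftrightarrow> (\<forall>a\<in>set D. is_fact a \<and> is_edb (apred a))"

definition fact_rule :: "atom \<Rightarrow> rule" where
  "fact_rule a = Rule [] a"

definition fact_time :: "atom \<Rightarrow> int" where
  "fact_time a = (case last (aargs a) of TConst k \<Rightarrow> k | _ \<Rightarrow> 0)"

datatype gval = GO nat | GT int

type_synonym gatom = "pred \<times> gval list"

fun eval_term :: "(nat \<Rightarrow> nat) \<Rightarrow> (nat \<Rightarrow> int) \<Rightarrow> tm \<Rightarrow> gval" where
  "eval_term so st (OConst c) = GO c"
| "eval_term so st (OVar x) = GO (so x)"
| "eval_term so st (TConst k) = GT k"
| "eval_term so st (TVar t) = GT (st t)"
| "eval_term so st (TPlus t k) = GT (st t + k)"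

definition inst_atom :: "(nat \<Rightarrow> nat) \<Rightarrow> (nat \<Rightarrow> int) \<Rightarrow> atom \<Rightarrow> gatom" where
  "inst_atom so st a = (apred a, map (eval_term so st) (aargs a))"

text \<open>Rules are universally quantified sentences, + is integer addition.
  Interpretations are Herbrand interpretations: the object domain is the set
  of objects (constants), the time domain is the integers; an interpretation
  is a set of ground atoms.\<close>
definition satisfies_rule :: "gatom set \<Rightarrow> rule \<Rightarrow> bool" where
  "satisfies_rule I r \<longleftrightarrow>
     (\<forall>so st. (\<forall>b\<in>set (body r). inst_atom so st b \<in> I) \<longrightarrow> inst_atom so st (head r) \<in> I)"

definition entails :: "rule set \<Rightarrow> gatom \<Rightarrow> bool" where
  "entails \<Pi> \<alpha> \<longleftrightarrow> (\<forall>I. (\<forall>r\<in>\<Pi>. satisfies_rule I r) \<longrightarrow> \<alpha> \<in> I)"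

type_synonym query = "pred \<times> rule list"

definition preds_of_program :: "rule list \<Rightarrow> pred set" where
  "preds_of_program \<Pi> = (\<Union>r\<in>set \<Pi>. apred ` set (head r # body r))"

definition temporal_query :: "query \<Rightarrow> bool" where
  "temporal_query Q \<longleftrightarrow> wf_program (snd Q) \<and> fst Q \<in> preds_of_program (snd Q)
      \<and> \<not> is_edb (fst Q) \<and> temporal_pred (fst Q)"

definition answers :: "query \<Rightarrow> atom set \<Rightarrow> int \<Rightarrow> nat list set" where
  "answers Q D \<tau> = {os. entails (set (snd Q) \<union> fact_rule ` D) (fst Q, map GO os @ [GT \<tau>])}"

definition restrict :: "atom set \<Rightarrow> int \<Rightarrow> atom set" where
  "restrict D \<tau> = {a\<in>D. rigid_atom a} \<union> {a\<in>D. temporal_atom a \<and> fact_time a > \<tau>}"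

definition is_history :: "int \<Rightarrow> atom list \<Rightarrow> bool" where
  "is_history \<tau>in D \<longleftrightarrow> is_dataset D \<and>
     (\<forall>a\<in>set D. rigid_atom a \<or> (temporal_atom a \<and> fact_time a \<le> \<tau>in))"

definition is_update :: "int \<Rightarrow> atom list \<Rightarrow> bool" where
  "is_update \<tau>in U \<longleftrightarrow> is_dataset U \<and>
     (\<forall>a\<in>set U. temporal_atom a \<and> fact_time a > \<tau>in)"

type_synonym forget_instance = "query \<times> atom list \<times> int \<times> int \<times> int"

definition valid_forget_instance :: "forget_instance \<Rightarrow> bool" where
  "valid_forget_instance x = (case x of (Q, D, \<tau>in, \<tau>out, \<tau>mem) \<Rightarrow>
     temporal_query Q \<and> is_history \<tau>in D \<and> \<tau>mem \<le> \<tau>out \<and> \<tau>out \<le> \<tau>in)"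

definition forget_holds :: "forget_instance \<Rightarrow> bool" where
  "forget_holds x = (case x of (Q, D, \<tau>in, \<tau>out, \<tau>mem) \<Rightarrow>
     (\<forall>U \<tau>. is_update \<tau>in U \<and> \<tau> \<ge> \<tau>out \<longrightarrow>
        answers Q (set D \<union> set U) \<tau> = answers Q (restrict (set D) \<tau>mem \<union> set U) \<tau>))"

definition enc_sort :: "sort \<Rightarrow> nat" where
  "enc_sort s = (case s of ObjS \<Rightarrow> 0 | TimeS \<Rightarrow> 1)"

definition enc_bool :: "bool \<Rightarrow> nat" where
  "enc_bool b = (if b then 1 else 0)"

definition enc_pred :: "pred \<Rightarrow> nat" where
  "enc_pred P = list_encode [pname P, enc_bool (is_edb P), list_encode (map enc_sort (psorts P))]"

fun enc_term :: "tm \<Rightarrow> nat" where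
  "enc_term (OConst c) = list_encode [0, c]"
| "enc_term (OVar x) = list_encode [1, x]"
| "enc_term (TConst k) = list_encode [2, int_encode k]"
| "enc_term (TVar t) = list_encode [3, t]"
| "enc_term (TPlus t k) = list_encode [4, t, int_encode k]"

definition enc_atom :: "atom \<Rightarrow> nat" where
  "enc_atom a = list_encode [enc_pred (apred a), list_encode (map enc_term (aargs a))]"

definition enc_rule :: "rule \<Rightarrow> nat" where
  "enc_rule r = list_encode [list_encode (map enc_atom (body r)), enc_atom (head r)]"

definition enc_instance :: "forget_instance \<Rightarrow> nat" where
  "enc_instance x = (case x of ((P, \<Pi>), D, \<tau>in, \<tau>out, \<tau>mem) \<Rightarrow>
     list_encode [enc_pred P, list_encode (map enc_rule \<Pi>), list_encode (map enc_atom D),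
                  int_encode \<tau>in, int_encode \<tau>out, int_encode \<tau>mem])"

datatype recf = Zero | Succ | Proj nat | Comp recf "recf list" | PrimRec recf recf | Mn recf

inductive eval :: "recf \<Rightarrow> nat list \<Rightarrow> nat \<Rightarrow> bool" where
  zero: "eval Zero xs 0"
| succ: "eval Succ (x # xs) (Suc x)"
| proj: "i < length xs \<Longrightarrow> eval (Proj i) xs (xs ! i)"
| comp: "list_all2 (\<lambda>g y. eval g xs y) gs ys \<Longrightarrow> eval f ys z \<Longrightarrow> eval (Comp f gs) xs z"
| prec0: "eval f xs y \<Longrightarrow> eval (PrimRec f g) (0 # xs) y"
| precS: "eval (PrimRec f g) (n # xs) y \<Longrightarrow> eval g (n # y # xs) z \<Longrightarrow>
           eval (PrimRec f g) (Suc n # xs) z"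
| mn: "eval f (n # xs) 0 \<Longrightarrow> (\<forall>m<n. \<exists>y. eval f (m # xs) y \<and> y \<noteq> 0) \<Longrightarrow>
        eval (Mn f) xs n"

definition decidable_on :: "('a \<Rightarrow> nat) \<Rightarrow> ('a \<Rightarrow> bool) \<Rightarrow> ('a \<Rightarrow> bool) \<Rightarrow> bool" where
  "decidable_on enc valid P \<longleftrightarrow>
     (\<exists>f. \<forall>x. valid x \<longrightarrow> eval f [enc x] (if P x then 1 else 0))"

end

theory Submission
  imports Defs "HOL-Library.Countable" Complex_Main
begin

text \<open>
  The undecidability is obtained by diagonalisation. Every recursive function compiles to a
  positive Datalog program over rigid predicates whose objects are names of numbers: an update
  supplies the names by facts \<open>Num o (n + 1)\<close>, read as ``\<open>o\<close> names \<open>n\<close>''. Negation is not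
  available, but an update that lets one object name two different numbers derives the
  goal without any help from the history (the order of time is definable), so it cannot separate
  the two sides of Forget. For all other updates, the goal holds exactly if the single fact of the
  history yields an input \<open>x\<close> for which the update contains enough names to carry out a computation
  of \<open>g x = 1\<close>. Hence Forget holds for this instance iff \<open>g x \<noteq> 1\<close>. If \<open>f\<close> decided Forget, let
  \<open>g x\<close> be \<open>f\<close> applied to the code of the instance with input \<open>x\<close> and the program coded by \<open>x\<close>, and
  take for \<open>x\<close> the code of the program for \<open>g\<close> itself.
\<close>

section \<open>Recursive functions\<close>

instance recf :: countable
  by countable_datatype

inductive_cases eval_ZeroE: "eval Zero xs y"
inductive_cases eval_SuccE: "eval Succ xs y"
inductive_cases eval_ProjE: "eval (Proj i) xs y"
inductive_cases eval_CompE: "eval (Comp f gs) xs y"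
inductive_cases eval_PrimRec0E: "eval (PrimRec f g) (0 # xs) y"
inductive_cases eval_PrimRecSucE: "eval (PrimRec f g) (Suc n # xs) y"
inductive_cases eval_MnE: "eval (Mn f) xs y"

lemma eval_deterministic: "eval f xs y \<Longrightarrow> eval f xs z \<Longrightarrow> y = z"
proof (induction arbitrary: z rule: eval.induct)
  case (comp xs gs ys f y)
  from comp.prems obtain ys' where ys': "list_all2 (\<lambda>g y. eval g xs y) gs ys'" "eval f ys' z"
    by (rule eval_CompE)
  have "ys ! i = ys' ! i" if "i < length ys" for i
    using comp.IH(1) ys'(1) that unfolding list_all2_conv_all_nth by metis
  moreover have "length ys = length ys'"
    using comp.IH(1) ys'(1) unfolding list_all2_conv_all_nth by metis
  ultimately have "ys = ys'" by (rule nth_equalityI[rotated])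
  with comp.IH(2) ys'(2) show ?case by blast
next
  case (mn f n xs)
  from mn.prems have z: "eval f (z # xs) 0" "\<forall>m<z. \<exists>y. eval f (m # xs) y \<and> y \<noteq> 0"
    by (rule eval_MnE, simp)+
  show ?case
  proof (rule linorder_cases[of n z])
    assume "n < z"
    with z(2) mn.IH(1) show ?thesis by metis
  next
    assume "z < n"
    with z(1) mn.IH(2) show ?thesis by metis
  qed
next
  case (zero xs)
  then show ?case by (rule eval_ZeroE) simp
next
  case (succ x xs)
  then show ?case by (rule eval_SuccE) simp
next
  case (proj i xs)
  from proj.prems show ?case by (rule eval_ProjE) simp
next
  case (prec0 f xs y g)
  from prec0.prems have "eval f xs z" by (rule eval_PrimRec0E)
  with prec0.IH show ?case by blast
next
  case (precS f g n xs y z')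
  from precS.prems obtain w where "eval (PrimRec f g) (n # xs) w" "eval g (n # w # xs) z"
    by (rule eval_PrimRecSucE)
  with precS.IH show ?case by metis
qed

section \<open>Unary computable functions and the coding of pairs and lists\<close>

definition unary_rec :: "(nat \<Rightarrow> nat) \<Rightarrow> bool" where
  "unary_rec h \<longleftrightarrow> (\<exists>r. \<forall>x. eval r [x] (h x))"

lemma eval_Comp1: "eval g xs y \<Longrightarrow> eval f [y] z \<Longrightarrow> eval (Comp f [g]) xs z"
  by (rule eval.comp[where ys = "[y]"]) auto

lemma eval_Comp2:
  "eval g xs y \<Longrightarrow> eval h xs y' \<Longrightarrow> eval f [y, y'] z \<Longrightarrow> eval (Comp f [g, h]) xs z"
  by (rule eval.comp[where ys = "[y, y']"]) auto

lemma eval_Proj: "i < length xs \<Longrightarrow> y = xs ! i \<Longrightarrow> eval (Proj i) xs y"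
  by (simp add: eval.proj)

lemma unary_rec_id: "unary_rec (\<lambda>x. x)"
  unfolding unary_rec_def by (auto intro!: exI[of _ "Proj 0"] eval_Proj)

lemma unary_rec_Suc: "unary_rec h \<Longrightarrow> unary_rec (\<lambda>x. Suc (h x))"
  unfolding unary_rec_def using eval_Comp1 eval.succ by blast

lemma unary_rec_const: "unary_rec (\<lambda>x. c)"
proof (induction c)
  case 0
  show ?case unfolding unary_rec_def using eval.zero by blast
qed (rule unary_rec_Suc)

definition add_recf :: recf where
  "add_recf = PrimRec (Proj 0) (Comp Succ [Proj 1])"

lemma eval_add_recf: "eval add_recf [m, n] (m + n)"
proof (induction m)
  case 0
  show ?case by (auto simp: add_recf_def intro!: eval.prec0 eval_Proj)
next
  case (Suc m)
  have "eval (Comp Succ [Proj 1]) [m, m + n, n] (Suc (m + n))"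
    by (rule eval_Comp1[OF eval_Proj eval.succ]) auto
  with Suc show ?case by (auto simp: add_recf_def intro: eval.precS)
qed

lemma unary_rec_add: "unary_rec h \<Longrightarrow> unary_rec k \<Longrightarrow> unary_rec (\<lambda>x. h x + k x)"
  unfolding unary_rec_def using eval_Comp2 eval_add_recf by meson

lemma unary_rec_triangle: "unary_rec triangle"
proof -
  let ?g = "Comp add_recf [Proj 1, Comp Succ [Proj 0]]"
  have "eval (PrimRec Zero ?g) [n] (triangle n)" for n
  proof (induction n)
    case 0
    show ?case by (auto intro: eval.prec0 eval.zero)
  next
    case (Suc n)
    have "eval (Comp Succ [Proj 0]) [n, triangle n] (Suc n)"
      by (rule eval_Comp1[OF eval_Proj eval.succ]) auto
    then have "eval ?g [n, triangle n] (triangle n + Suc n)"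
      by (intro eval_Comp2[OF eval_Proj _ eval_add_recf]) auto
    with Suc show ?case by (auto intro: eval.precS)
  qed
  then show ?thesis unfolding unary_rec_def by blast
qed

lemma unary_rec_comp: "unary_rec h \<Longrightarrow> unary_rec k \<Longrightarrow> unary_rec (\<lambda>x. h (k x))"
  unfolding unary_rec_def using eval_Comp1 by meson

lemma unary_rec_prod_encode:
  "unary_rec h \<Longrightarrow> unary_rec k \<Longrightarrow> unary_rec (\<lambda>x. prod_encode (h x, k x))"
  unfolding prod_encode_def
  by (simp add: unary_rec_add unary_rec_comp[OF unary_rec_triangle])

lemma unary_rec_list_encode_Nil: "unary_rec (\<lambda>x. list_encode [])"
  by (simp add: unary_rec_const)

lemma unary_rec_list_encode_Cons:
  "unary_rec h \<Longrightarrow> unary_rec (\<lambda>x. list_encode (hs x)) \<Longrightarrow>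
    unary_rec (\<lambda>x. list_encode (h x # hs x))"
  by (simp add: unary_rec_Suc unary_rec_prod_encode)

section \<open>Compiling recursive functions to Datalog\<close>

definition Num :: pred where "Num = Pred 0 True [ObjS, TimeS]"
definition Inp :: pred where "Inp = Pred 0 True [TimeS]"
definition Later :: pred where "Later = Pred 0 False [ObjS, TimeS]"
definition Count :: pred where "Count = Pred 1 False [ObjS, TimeS]"
definition Goal :: pred where "Goal = Pred 0 False [TimeS]"

text \<open>The first \<open>n\<close> arguments are the inputs and the last one is the value. These
  predicates are rigid, which separates them from the five above; the Boolean inside the name
  separates them from the search predicates.\<close>

definition Ev :: "recf \<Rightarrow> nat \<Rightarrow> pred" where
  "Ev f n = Pred (to_nat (f, True)) False (replicate (Suc n) ObjS)"

text \<open>The search predicate for minimisation: its first argument is a number below which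
  all values of the function are nonzero.\<close>
definition Srch :: "recf \<Rightarrow> nat \<Rightarrow> pred" where
  "Srch f n = Pred (to_nat (f, False)) False (replicate (Suc n) ObjS)"

lemmas fixed_pred_defs = Num_def Inp_def Later_def Count_def Goal_def

lemma pred_distinct [simp]:
  "Num \<noteq> Inp" "Num \<noteq> Later" "Num \<noteq> Count" "Num \<noteq> Goal" "Num \<noteq> Ev f n" "Num \<noteq> Srch f n"
  "Inp \<noteq> Num" "Inp \<noteq> Later" "Inp \<noteq> Count" "Inp \<noteq> Goal" "Inp \<noteq> Ev f n" "Inp \<noteq> Srch f n"
  "Later \<noteq> Num" "Later \<noteq> Inp" "Later \<noteq> Count" "Later \<noteq> Goal" "Later \<noteq> Ev f n" "Later \<noteq> Srch f n"
  "Count \<noteq> Num" "Count \<noteq> Inp" "Count \<noteq> Later" "Count \<noteq> Goal" "Count \<noteq> Ev f n" "Count \<noteq> Srch f n"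
  "Goal \<noteq> Num" "Goal \<noteq> Inp" "Goal \<noteq> Later" "Goal \<noteq> Count" "Goal \<noteq> Ev f n" "Goal \<noteq> Srch f n"
  "Ev f n \<noteq> Num" "Ev f n \<noteq> Inp" "Ev f n \<noteq> Later" "Ev f n \<noteq> Count" "Ev f n \<noteq> Goal"
  "Ev f n \<noteq> Srch g m"
  "Srch f n \<noteq> Num" "Srch f n \<noteq> Inp" "Srch f n \<noteq> Later" "Srch f n \<noteq> Count" "Srch f n \<noteq> Goal"
  "Srch f n \<noteq> Ev g m"
  by (auto simp: fixed_pred_defs Ev_def Srch_def Cons_eq_append_conv dest!: arg_cong[where f = set])

lemma Ev_inject [simp]: "Ev f n = Ev g m \<longleftrightarrow> f = g \<and> n = m"
  by (auto simp: Ev_def dest: arg_cong[where f = length])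

lemma Srch_inject [simp]: "Srch f n = Srch g m \<longleftrightarrow> f = g \<and> n = m"
  by (auto simp: Srch_def dest: arg_cong[where f = length])

definition num :: "nat \<Rightarrow> tm \<Rightarrow> atom" where
  "num i t = Atom Num [OVar i, t]"

definition objs :: "pred \<Rightarrow> nat list \<Rightarrow> atom" where
  "objs P is = Atom P (map OVar is)"

text \<open>These atoms bind the argument variables of a rule, so that every head variable occurs in
  the body even where the value does not depend on it.\<close>

definition dom_atoms :: "nat \<Rightarrow> atom list" where
  "dom_atoms n = map (\<lambda>i. num i (TVar i)) [0..<n]"

text \<open>Object variables below \<open>n\<close> are the arguments, \<open>n\<close> is the value
  (for minimisation also the counter of the search), and larger indices are auxiliary. Time 1 stands
  for zero and a shift by 1 for the successor. In minimisation, being nonzero is expressed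
  positively: variable \<open>n + 2\<close> names a predecessor of the value. Arities at which a
  function is undefined get no rules.\<close>

fun compile :: "recf \<Rightarrow> nat \<Rightarrow> rule list" where
  "compile Zero n =
     [Rule (num n (TConst 1) # dom_atoms n) (objs (Ev Zero n) ([0..<n] @ [n]))]"
| "compile Succ n = (case n of 0 \<Rightarrow> [] | Suc k \<Rightarrow>
     [Rule (num 0 (TVar n) # num n (TPlus n 1) # dom_atoms n)
        (objs (Ev Succ n) (0 # [1..<n] @ [n]))])"
| "compile (Proj i) n = (if n \<le> i then [] else
     [Rule (num i (TVar n) # num n (TVar n) # dom_atoms n)
        (objs (Ev (Proj i) n) ([0..<n] @ [n]))])"
| "compile (Comp f gs) n =
     compile f (length gs) @ concat (map (\<lambda>g. compile g n) gs) @
     [Rule (objs (Ev f (length gs)) ([Suc n..<Suc n + length gs] @ [n])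
             # map (\<lambda>j. objs (Ev (gs ! j) n) ([0..<n] @ [Suc n + j])) [0..<length gs]
             @ dom_atoms n)
        (objs (Ev (Comp f gs) n) ([0..<n] @ [n]))]"
| "compile (PrimRec f g) n = (case n of 0 \<Rightarrow> [] | Suc k \<Rightarrow>
     compile f k @ compile g (Suc n) @
     [Rule [num 0 (TConst 1), objs (Ev f k) ([1..<n] @ [n])]
        (objs (Ev (PrimRec f g) n) (0 # [1..<n] @ [n])),
      Rule [num 0 (TPlus 0 1), num (n + 1) (TVar 0),
            objs (Ev (PrimRec f g) n) ((n + 1) # [1..<n] @ [n + 2]),
            objs (Ev g (Suc n)) ((n + 1) # (n + 2) # [1..<n] @ [n])]
        (objs (Ev (PrimRec f g) n) (0 # [1..<n] @ [n]))])"
| "compile (Mn f) n =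
     compile f (Suc n) @
     [Rule (num n (TConst 1) # dom_atoms n) (objs (Srch f n) (n # [0..<n])),
      Rule [objs (Srch f n) (n # [0..<n]), objs (Ev f (Suc n)) (n # [0..<n] @ [n + 1]),
            num (n + 1) (TPlus 0 1), num (n + 2) (TVar 0),
            num n (TVar 1), num (n + 3) (TPlus 1 1)]
        (objs (Srch f n) ((n + 3) # [0..<n])),
      Rule [objs (Srch f n) (n # [0..<n]), objs (Ev f (Suc n)) (n # [0..<n] @ [n + 1]),
            num (n + 1) (TConst 1)]
        (objs (Ev (Mn f) n) ([0..<n] @ [n]))]"

text \<open>The three rules with \<open>Later\<close> detect an object that names two numbers. The
  \<open>Count\<close> rules turn the time point of the input into an object naming it, stepping
  from zero through successors. In the last rule, time 2 stands for the value 1.\<close>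

definition program :: "recf \<Rightarrow> rule list" where
  "program g = compile g 1 @
     [Rule [num 0 (TVar 0)] (Atom Later [OVar 0, TPlus 0 1]),
      Rule [Atom Later [OVar 0, TVar 0]] (Atom Later [OVar 0, TPlus 0 1]),
      Rule [Atom Later [OVar 0, TVar 0], num 0 (TVar 0)] (Atom Goal [TConst 0]),
      Rule [Atom Inp [TVar 0], num 0 (TConst 1)] (Atom Count [OVar 0, TVar 0]),
      Rule [Atom Count [OVar 0, TVar 0], num 0 (TVar 1), num 1 (TPlus 1 1)]
        (Atom Count [OVar 1, TPlus 0 1]),
      Rule [Atom Count [OVar 0, TConst (- 1)], objs (Ev g 1) [0, 1], num 1 (TConst 2)]
        (Atom Goal [TConst 0])]"

section \<open>Instances of the atoms and well-formedness of the rules\<close>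

lemma inst_atom_simps [simp]:
  "inst_atom so st (Atom P ts) = (P, map (eval_term so st) ts)"
  "inst_atom so st (num i t) = (Num, [GO (so i), eval_term so st t])"
  "inst_atom so st (objs P is) = (P, map (\<lambda>i. GO (so i)) is)"
  by (simp_all add: inst_atom_def num_def objs_def)

lemma wf_atom_simps [simp]:
  "temporal_atom (num i t) \<longleftrightarrow> term_sort t = TimeS"
  "rigid_atom (objs (Ev f n) is) \<longleftrightarrow> length is = Suc n"
  "rigid_atom (objs (Srch f n) is) \<longleftrightarrow> length is = Suc n"
  "temporal_atom (Atom Later [OVar i, t]) \<longleftrightarrow> term_sort t = TimeS"
  "temporal_atom (Atom Count [OVar i, t]) \<longleftrightarrow> term_sort t = TimeS"
  "temporal_atom (Atom Goal [t]) \<longleftrightarrow> term_sort t = TimeS"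
  "temporal_atom (Atom Inp [t]) \<longleftrightarrow> term_sort t = TimeS"
  by (auto simp: temporal_atom_def rigid_atom_def well_sorted_def temporal_pred_def rigid_pred_def
      num_def objs_def fixed_pred_defs Ev_def Srch_def comp_def map_replicate_const
      dest: arg_cong[where f = length] simp del: replicate_Suc)

lemma not_edb [simp]: "\<not> is_edb (apred (objs (Ev f n) is))" "\<not> is_edb (apred (objs (Srch f n) is))"
  "\<not> is_edb Later" "\<not> is_edb Count" "\<not> is_edb Goal"
  by (simp_all add: fixed_pred_defs Ev_def Srch_def objs_def)

lemma atom_vars_simps [simp]:
  "atom_vars (Atom P ts) = (\<Union>t\<in>set ts. term_vars t)"
  "atom_vars (num i t) = insert (Inl i) (term_vars t)"
  "atom_vars (objs P is) = Inl ` set is"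
  by (auto simp: atom_vars_def num_def objs_def)

lemma wf_rule_Rule:
  "wf_rule (Rule bd h) \<longleftrightarrow>
     (\<forall>a\<in>set (h # bd). rigid_atom a \<or> temporal_atom a) \<and>
     (bd \<noteq> [] \<longrightarrow> \<not> is_edb (apred h)) \<and> atom_vars h \<subseteq> (\<Union>a\<in>set bd. atom_vars a)"
  by (simp add: wf_rule_def)

lemma wf_compile: "r \<in> set (compile f n) \<Longrightarrow> wf_rule r"
proof (induction f n arbitrary: r rule: compile.induct)
  case (4 f gs n)
  then show ?case
    by (fastforce simp: wf_rule_Rule dom_atoms_def simp del: upt_Suc)
qed (auto simp: wf_rule_Rule dom_atoms_def simp del: upt_Suc split: if_splits nat.splits)

lemma wf_program_program: "wf_program (program g)"
  unfolding wf_program_def program_def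
  by (auto dest: wf_compile) (auto simp: wf_rule_def)

section \<open>Soundness\<close>

text \<open>The value at a time point is arbitrary: the rules apply \<open>Ev\<close> and
  \<open>Srch\<close> to objects only.\<close>

fun obj :: "gval \<Rightarrow> nat" where
  "obj (GO c) = c"
| "obj (GT k) = 0"

text \<open>Here \<^term>\<open>v\<close> gives the number named by an object; the number \<^term>\<open>n\<close> is
  represented by the time point \<^term>\<open>n + 1\<close> and the input \<^term>\<open>x\<close> by the fact that
  \<^const>\<open>Inp\<close> holds at \<^term>\<open>- x - 1\<close>. Counting up from there, \<^const>\<open>Count\<close> reaches
  the number \<^term>\<open>x\<close> at time \<^term>\<open>- 1\<close>; its behaviour at nonnegative times is
  irrelevant, so an update may put \<^const>\<open>Inp\<close> at any time it likes.\<close>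

definition model :: "(nat \<Rightarrow> nat) \<Rightarrow> nat set \<Rightarrow> recf \<Rightarrow> gatom set" where
  "model v X g = {(P, vs).
     (P = Num \<longrightarrow> (\<exists>ob. vs = [GO ob, GT (int (v ob) + 1)])) \<and>
     (P = Later \<longrightarrow> (\<exists>ob t. vs = [GO ob, GT t] \<and> int (v ob) + 1 < t)) \<and>
     (P = Inp \<longrightarrow> (\<exists>t. vs = [GT t] \<and> (0 < t \<or> (\<exists>x\<in>X. t = - int x - 1)))) \<and>
     (P = Count \<longrightarrow> (\<exists>ob t. vs = [GO ob, GT t] \<and> (0 \<le> t \<or> (\<exists>x\<in>X. int (v ob) = t + int x + 1)))) \<and>
     (P = Goal \<longrightarrow> vs = [GT 0] \<and> (\<exists>x\<in>X. eval g [x] 1)) \<and>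
     (\<forall>f n. P = Ev f n \<longrightarrow> eval f (map (v \<circ> obj) (butlast vs)) (v (obj (last vs)))) \<and>
     (\<forall>f n. P = Srch f n \<longrightarrow>
        (\<forall>m<v (obj (hd vs)). \<exists>y. eval f (m # map (v \<circ> obj) (tl vs)) y \<and> y \<noteq> 0))}"

lemma in_model_simps [simp]:
  "(Num, vs) \<in> model v X g \<longleftrightarrow> (\<exists>ob. vs = [GO ob, GT (int (v ob) + 1)])"
  "(Later, vs) \<in> model v X g \<longleftrightarrow> (\<exists>ob t. vs = [GO ob, GT t] \<and> int (v ob) + 1 < t)"
  "(Inp, vs) \<in> model v X g \<longleftrightarrow> (\<exists>t. vs = [GT t] \<and> (0 < t \<or> (\<exists>x\<in>X. t = - int x - 1)))"
  "(Count, vs) \<in> model v X g \<longleftrightarrow>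
     (\<exists>ob t. vs = [GO ob, GT t] \<and> (0 \<le> t \<or> (\<exists>x\<in>X. int (v ob) = t + int x + 1)))"
  "(Goal, vs) \<in> model v X g \<longleftrightarrow> vs = [GT 0] \<and> (\<exists>x\<in>X. eval g [x] 1)"
  "(Ev f n, vs) \<in> model v X g \<longleftrightarrow> eval f (map (v \<circ> obj) (butlast vs)) (v (obj (last vs)))"
  "(Srch f n, vs) \<in> model v X g \<longleftrightarrow>
     (\<forall>m<v (obj (hd vs)). \<exists>y. eval f (m # map (v \<circ> obj) (tl vs)) y \<and> y \<noteq> 0)"
  by (simp_all add: model_def)

lemma butlast_Cons_snoc [simp]: "butlast (x # xs @ [y]) = x # xs"
  by (simp add: butlast_append)

lemma int_add_1_eq_iff:
  "int m = int n + 1 \<longleftrightarrow> m = Suc n" "int n + 1 = int m \<longleftrightarrow> m = Suc n"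
  by linarith+

text \<open>As \<open>v\<close> is a function, the shared time terms of the naming atoms turn into
  equations between numbers, and each rule becomes one evaluation clause or one step of the
  search.\<close>

lemma model_compile: "r \<in> set (compile f n) \<Longrightarrow> satisfies_rule (model v X g) r"
proof (induction f n arbitrary: r rule: compile.induct)
  case (1 n)
  then show ?case by (auto simp: satisfies_rule_def comp_def int_add_1_eq_iff intro: eval.zero)
next
  case (2 n)
  then show ?case
    by (auto simp: satisfies_rule_def comp_def int_add_1_eq_iff eval.succ simp del: upt_Suc split: nat.splits)
next
  case (3 i n)
  then show ?case
    by (auto simp: satisfies_rule_def comp_def int_add_1_eq_iff split: if_splits intro!: eval_Proj)
next
  case (4 f gs n)
  have "satisfies_rule (model v X g)
    (Rule (objs (Ev f (length gs)) ([Suc n..<Suc n + length gs] @ [n])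
             # map (\<lambda>j. objs (Ev (gs ! j) n) ([0..<n] @ [Suc n + j])) [0..<length gs]
             @ dom_atoms n)
        (objs (Ev (Comp f gs) n) ([0..<n] @ [n])))"
    by (auto simp: satisfies_rule_def comp_def int_add_1_eq_iff list_all2_conv_all_nth ball_Un simp del: upt_Suc
        intro!: eval.comp)
  with 4 show ?case by auto
next
  case (5 f g n)
  show ?case
  proof (cases n)
    case 0
    with 5 show ?thesis by simp
  next
    case (Suc k)
    \<comment> \<open>This is \<open>eval.precS\<close> with the successor as an equation, the form
      in which the model supplies it.\<close>
    have "eval (PrimRec f g) (m # xs) z" if "m = Suc l" "eval (PrimRec f g) (l # xs) y"
      "eval g (l # y # xs) z" for m l y z xs
      using that eval.precS[of f g l xs y z] by simp
    with 5 Suc show ?thesis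
      by (auto simp: satisfies_rule_def comp_def int_add_1_eq_iff eval.prec0 simp del: upt_Suc)
  qed
next
  case (6 f n)
  let ?I = "model v X g"
  have "satisfies_rule ?I (Rule (num n (TConst 1) # dom_atoms n) (objs (Srch f n) (n # [0..<n])))"
    by (auto simp: satisfies_rule_def)
  \<comment> \<open>Only the old counter joins the range to be checked; its value has a named
    predecessor and so is nonzero.\<close>
  moreover have "satisfies_rule ?I
    (Rule [objs (Srch f n) (n # [0..<n]), objs (Ev f (Suc n)) (n # [0..<n] @ [n + 1]),
            num (n + 1) (TPlus 0 1), num (n + 2) (TVar 0),
            num n (TVar 1), num (n + 3) (TPlus 1 1)]
        (objs (Srch f n) ((n + 3) # [0..<n])))"
    by (auto simp: satisfies_rule_def comp_def int_add_1_eq_iff elim!: less_SucE)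
  moreover have "satisfies_rule ?I
    (Rule [objs (Srch f n) (n # [0..<n]), objs (Ev f (Suc n)) (n # [0..<n] @ [n + 1]),
            num (n + 1) (TConst 1)]
        (objs (Ev (Mn f) n) ([0..<n] @ [n])))"
    by (auto simp: satisfies_rule_def comp_def intro: eval.mn)
  ultimately show ?case using 6 by auto
qed

text \<open>The \<open>Later\<close> test never fires, since \<open>v\<close> gives an object one
  number only. At time - 1 the model admits \<open>Count\<close> solely for an object naming an
  element of \<open>X\<close>, which the last rule feeds to \<open>g\<close>.\<close>

lemma model_program: "r \<in> set (program g) \<Longrightarrow> satisfies_rule (model v X g) r"
  unfolding program_def
  by (auto dest: model_compile) (auto simp: satisfies_rule_def)

section \<open>Completeness\<close>

lemma satisfies_ruleD:
  "satisfies_rule I (Rule bd h) \<Longrightarrow>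
    (\<forall>b\<in>set bd. inst_atom so st b \<in> I) \<longrightarrow> inst_atom so st h \<in> I"
  by (auto simp: satisfies_rule_def)

text \<open>Here object \<open>i\<close> names number \<open>i\<close>, and only the names up to
  \<open>N\<close> are supplied, because an update is finite.\<close>

definition derived :: "recf \<Rightarrow> nat list \<Rightarrow> nat \<Rightarrow> nat \<Rightarrow> bool" where
  "derived f xs y N \<longleftrightarrow> (\<forall>I. (\<forall>r\<in>set (compile f (length xs)). satisfies_rule I r) \<longrightarrow>
     (\<forall>i\<le>N. (Num, [GO i, GT (int i + 1)]) \<in> I) \<longrightarrow>
     (Ev f (length xs), map GO xs @ [GO y]) \<in> I)"

lemma map_nth_prefix [simp]: "map (\<lambda>i. GO ((xs @ ys) ! i)) [0..<length xs] = map GO xs"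
  by (rule nth_equalityI) (auto simp: nth_append)

lemma map_nth_middle [simp]:
  "map (\<lambda>i. GO ((x # xs @ ys) ! i)) [Suc 0..<Suc (length xs)] = map GO xs"
  by (rule nth_equalityI) (auto simp: nth_append simp del: upt_Suc)

lemma map_nth_suffix [simp]:
  "map (\<lambda>i. GO ((xs @ z # ys) ! i)) [Suc (length xs)..<Suc (length xs + length ys)] = map GO ys"
  by (rule nth_equalityI) (auto simp: nth_append simp del: upt_Suc)

lemma nth_append_Suc:
  "(xs @ ys) ! Suc (length xs) = ys ! 1"
  "(xs @ ys) ! Suc (Suc (length xs)) = ys ! 2"
  "(xs @ ys) ! Suc (Suc (Suc (length xs))) = ys ! 3"
  "(xs @ ys) ! Suc (length xs + k) = ys ! Suc k"
  by (simp_all add: nth_append eval_nat_numeral)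

lemma eventually_bounds: "\<forall>\<^sub>F N in sequentially. \<forall>x\<in>set xs. x \<le> N"
  by (simp add: eventually_ball_finite eventually_ge_at_top)

text \<open>Object assignments are lookups in a list: the arguments first, then the value and
  auxiliary numbers in the order in which \<open>compile\<close> numbers its variables.\<close>

lemma inst_dom_atoms:
  assumes "\<forall>i\<le>N. (Num, [GO i, GT (int i + 1)]) \<in> I" and "\<forall>x\<in>set xs. x \<le> (N::nat)"
    and "\<forall>i<length xs. st i = int (xs ! i) + 1"
  shows "\<forall>b\<in>set (dom_atoms (length xs)). inst_atom (\<lambda>i. (xs @ ys) ! i) st b \<in> I"
  using assms by (auto simp: dom_atoms_def nth_append)

text \<open>A finite evaluation mentions finitely many numbers. Saying that all large
  \<open>N\<close> suffice combines the bounds of the subevaluations without computing a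
  maximum.\<close>

lemma eval_imp_eventually_derived: "eval f xs y \<Longrightarrow> \<forall>\<^sub>F N in sequentially. derived f xs y N"
proof (induction rule: eval.induct)
  case (zero xs)
  from eventually_bounds[of xs] show ?case
  proof eventually_elim
    case (elim N)
    show ?case unfolding derived_def
    proof (intro allI impI)
      fix I assume r: "\<forall>r\<in>set (compile Zero (length xs)). satisfies_rule I r"
        and num: "\<forall>i\<le>N. (Num, [GO i, GT (int i + 1)]) \<in> I"
      let ?so = "\<lambda>i. (xs @ [0]) ! i" and ?st = "\<lambda>i. int (xs ! i) + 1"
      from r have "satisfies_rule I (Rule (num (length xs) (TConst 1) # dom_atoms (length xs))
         (objs (Ev Zero (length xs)) ([0..<length xs] @ [length xs])))" by simp
      from satisfies_ruleD[OF this, of ?so ?st]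
      show "(Ev Zero (length xs), map GO xs @ [GO 0]) \<in> I"
        using num inst_dom_atoms[OF num elim, of ?st] by auto
    qed
  qed
next
  case (succ x xs)
  from eventually_bounds[of "Suc x # xs"] show ?case
  proof eventually_elim
    case (elim N)
    show ?case unfolding derived_def
    proof (intro allI impI)
      let ?n = "Suc (length xs)"
      fix I assume r: "\<forall>r\<in>set (compile Succ (length (x # xs))). satisfies_rule I r"
        and num: "\<forall>i\<le>N. (Num, [GO i, GT (int i + 1)]) \<in> I"
      \<comment> \<open>Time variable \<open>?n\<close> carries the time of \<open>x\<close>, shared
        by the two extra atoms; smaller indices serve \<open>dom_atoms\<close>.\<close>
      let ?so = "\<lambda>i. ((x # xs) @ [Suc x]) ! i"
        and ?st = "\<lambda>i. if i < ?n then int ((x # xs) ! i) + 1 else int x + 1"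
      from elim have xs: "\<forall>x\<in>set (x # xs). x \<le> N" by auto
      from r have "satisfies_rule I (Rule (num 0 (TVar ?n) # num ?n (TPlus ?n 1) # dom_atoms ?n)
        (objs (Ev Succ ?n) (0 # [1..<?n] @ [?n])))" by simp
      from satisfies_ruleD[OF this, of ?so ?st]
      show "(Ev Succ (length (x # xs)), map GO (x # xs) @ [GO (Suc x)]) \<in> I"
        using num[rule_format, of x] num[rule_format, of "Suc x"] elim
          inst_dom_atoms[OF num xs, of ?st "[Suc x]"]
        by (auto simp: add.commute simp del: upt_Suc)
    qed
  qed
next
  case (proj i xs)
  from eventually_bounds[of xs] show ?case
  proof eventually_elim
    case (elim N)
    show ?case unfolding derived_def
    proof (intro allI impI)
      let ?n = "length xs"
      fix I assume r: "\<forall>r\<in>set (compile (Proj i) (length xs)). satisfies_rule I r"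
        and num: "\<forall>i\<le>N. (Num, [GO i, GT (int i + 1)]) \<in> I"
      let ?so = "\<lambda>j. (xs @ [xs ! i]) ! j"
        and ?st = "\<lambda>j. if j < ?n then int (xs ! j) + 1 else int (xs ! i) + 1"
      from r proj have "satisfies_rule I (Rule (num i (TVar ?n) # num ?n (TVar ?n) # dom_atoms ?n)
        (objs (Ev (Proj i) ?n) ([0..<?n] @ [?n])))" by simp
      from satisfies_ruleD[OF this, of ?so ?st]
      show "(Ev (Proj i) (length xs), map GO xs @ [GO (xs ! i)]) \<in> I"
        using num elim proj inst_dom_atoms[OF num elim, of ?st]
        by (auto simp: nth_append_left)
    qed
  qed
next
  case (comp xs gs ys f z)
  have len: "length gs = length ys" using comp.IH(1) by (rule list_all2_lengthD)
  have "\<forall>\<^sub>F N in sequentially. \<forall>j\<in>{..<length ys}. derived (gs ! j) xs (ys ! j) N"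
    using comp.IH(1) by (intro eventually_ball_finite) (auto simp: list_all2_conv_all_nth)
  with comp.IH(2) eventually_bounds[of xs] show ?case
  proof eventually_elim
    case (elim N)
    show ?case unfolding derived_def
    proof (intro allI impI)
      let ?n = "length xs"
      fix I assume r: "\<forall>r\<in>set (compile (Comp f gs) (length xs)). satisfies_rule I r"
        and num: "\<forall>i\<le>N. (Num, [GO i, GT (int i + 1)]) \<in> I"
      let ?so = "\<lambda>i. (xs @ z # ys) ! i" and ?st = "\<lambda>i. int (xs ! i) + 1"
      have f: "(Ev f (length ys), map GO ys @ [GO z]) \<in> I"
        using elim(1) r num len by (auto simp: derived_def)
      have g: "(Ev (gs ! j) ?n, map GO xs @ [GO (ys ! j)]) \<in> I" if "j < length ys" for j
      proof -
        have "\<forall>r\<in>set (compile (gs ! j) ?n). satisfies_rule I r"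
          using r nth_mem[of j gs] that len by fastforce
        with elim(3) num that show ?thesis by (simp add: derived_def)
      qed
      from r len have "satisfies_rule I
        (Rule (objs (Ev f (length ys)) ([Suc ?n..<Suc ?n + length ys] @ [?n])
             # map (\<lambda>j. objs (Ev (gs ! j) ?n) ([0..<?n] @ [Suc ?n + j])) [0..<length ys]
             @ dom_atoms ?n)
        (objs (Ev (Comp f gs) ?n) ([0..<?n] @ [?n])))" by simp
      from satisfies_ruleD[OF this, of ?so ?st]
      show "(Ev (Comp f gs) (length xs), map GO xs @ [GO z]) \<in> I"
        using f g inst_dom_atoms[OF num elim(2), of ?st]
        by (auto simp: nth_append_Suc simp del: upt_Suc)
    qed
  qed
next
  case (prec0 f xs y g)
  from prec0.IH show ?case
  proof eventually_elim
    case (elim N)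
    show ?case unfolding derived_def
    proof (intro allI impI)
      let ?n = "Suc (length xs)"
      fix I assume r: "\<forall>r\<in>set (compile (PrimRec f g) (length (0 # xs))). satisfies_rule I r"
        and num: "\<forall>i\<le>N. (Num, [GO i, GT (int i + 1)]) \<in> I"
      let ?so = "\<lambda>i. (0 # xs @ [y]) ! i"
      have f: "(Ev f (length xs), map GO xs @ [GO y]) \<in> I"
        using elim r num by (simp add: derived_def ball_Un)
      from r have "satisfies_rule I (Rule [num 0 (TConst 1), objs (Ev f (length xs)) ([1..<?n] @ [?n])]
        (objs (Ev (PrimRec f g) ?n) (0 # [1..<?n] @ [?n])))" by (simp add: ball_Un)
      from satisfies_ruleD[OF this, of ?so "\<lambda>_. 0"]
      show "(Ev (PrimRec f g) (length (0 # xs)), map GO (0 # xs) @ [GO y]) \<in> I"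
        using f num by (auto simp: nth_append_Suc simp del: upt_Suc)
    qed
  qed
next
  case (precS f g n xs y z)
  from precS.IH eventually_ge_at_top[of "Suc n"] show ?case
  proof eventually_elim
    case (elim N)
    show ?case unfolding derived_def
    proof (intro allI impI)
      let ?n = "Suc (length xs)"
      fix I assume r: "\<forall>r\<in>set (compile (PrimRec f g) (length (Suc n # xs))). satisfies_rule I r"
        and num: "\<forall>i\<le>N. (Num, [GO i, GT (int i + 1)]) \<in> I"
      \<comment> \<open>After the arguments come the new value, the predecessor and the old
        value.\<close>
      let ?so = "\<lambda>i. (Suc n # xs @ [z, n, y]) ! i"
      have f: "(Ev (PrimRec f g) ?n, GO n # map GO xs @ [GO y]) \<in> I"
        using elim(1) r num by (simp add: derived_def)
      have g: "(Ev g (Suc ?n), GO n # GO y # map GO xs @ [GO z]) \<in> I"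
        using elim(2) r num by (simp add: derived_def ball_Un)
      from r have "satisfies_rule I (Rule [num 0 (TPlus 0 1), num (?n + 1) (TVar 0),
            objs (Ev (PrimRec f g) ?n) ((?n + 1) # [1..<?n] @ [?n + 2]),
            objs (Ev g (Suc ?n)) ((?n + 1) # (?n + 2) # [1..<?n] @ [?n])]
        (objs (Ev (PrimRec f g) ?n) (0 # [1..<?n] @ [?n])))" by (simp add: ball_Un)
      from satisfies_ruleD[OF this, of ?so "\<lambda>_. int n + 1"]
      show "(Ev (PrimRec f g) (length (Suc n # xs)), map GO (Suc n # xs) @ [GO z]) \<in> I"
        using f g num[rule_format, of n] num[rule_format, of "Suc n"] elim(3)
        by (auto simp: nth_append_Suc add.commute simp del: upt_Suc)
    qed
  qed
next
  case (mn f n xs)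
  \<comment> \<open>\<open>w m\<close> is the nonzero value of \<open>f\<close> at \<open>m\<close>,
    for each \<open>m\<close> that the search passes.\<close>
  then obtain w where w: "\<forall>m<n. w m \<noteq> 0 \<and> (\<forall>\<^sub>F N in sequentially. derived f (m # xs) (w m) N)"
    by metis
  have "\<forall>\<^sub>F N in sequentially. \<forall>m\<in>{..<n}. derived f (m # xs) (w m) N"
    using w by (intro eventually_ball_finite) auto
  \<comment> \<open>The values \<open>w m\<close> must be named too: the search tests them through
    their predecessors.\<close>
  with mn.IH(1) eventually_bounds[of "n # xs @ map w [0..<n]"] show ?case
  proof eventually_elim
    case (elim N)
    show ?case unfolding derived_def
    proof (intro allI impI)
      let ?n = "length xs"
      fix I assume r: "\<forall>r\<in>set (compile (Mn f) (length xs)). satisfies_rule I r"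
        and num: "\<forall>i\<le>N. (Num, [GO i, GT (int i + 1)]) \<in> I"
      have f: "(Ev f (Suc ?n), GO m # map GO xs @ [GO y]) \<in> I" if "derived f (m # xs) y N" for m y
        using that r num by (simp add: derived_def ball_Un)
      have srch: "(Srch f ?n, GO m # map GO xs) \<in> I" if "m \<le> n" for m
        using that
      proof (induction m)
        case 0
        let ?so = "\<lambda>i. (xs @ [0]) ! i" and ?st = "\<lambda>i. int (xs ! i) + 1"
        from elim(2) have xs: "\<forall>x\<in>set xs. x \<le> N" by auto
        from r have "satisfies_rule I
          (Rule (num ?n (TConst 1) # dom_atoms ?n) (objs (Srch f ?n) (?n # [0..<?n])))"
          by (simp add: ball_Un)
        from satisfies_ruleD[OF this, of ?so ?st] show ?case
          using num inst_dom_atoms[OF num xs, of ?st] by auto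
      next
        case (Suc m)
        \<comment> \<open>Time variable 0 is the time of \<open>w m - 1\<close>, which equals
          \<open>w m\<close> by the shift and because \<open>w m\<close> is nonzero; time variable 1
          is the time of \<open>m\<close>.\<close>
        let ?so = "\<lambda>i. (xs @ [m, w m, w m - 1, Suc m]) ! i"
          and ?st = "\<lambda>i::nat. if i = 0 then int (w m) else int m + 1"
        have wN: "w m \<le> N" using elim(2) Suc.prems by auto
        have N: "w m - 1 \<le> N" "w m \<noteq> 0" "m \<le> N" "Suc m \<le> N"
          using order_trans[OF diff_le_self wN] elim(2) w Suc.prems by auto
        from r have "satisfies_rule I
          (Rule [objs (Srch f ?n) (?n # [0..<?n]), objs (Ev f (Suc ?n)) (?n # [0..<?n] @ [?n + 1]),
            num (?n + 1) (TPlus 0 1), num (?n + 2) (TVar 0),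
            num ?n (TVar 1), num (?n + 3) (TPlus 1 1)]
          (objs (Srch f ?n) ((?n + 3) # [0..<?n])))"
          by (simp add: ball_Un)
        from satisfies_ruleD[OF this, of ?so ?st] show ?case
          using wN N Suc f[of m "w m"] elim(3) num[rule_format, OF wN] num[rule_format, OF N(1)]
            num[rule_format, OF N(3)] num[rule_format, OF N(4)]
          by (auto simp: nth_append_Suc add.commute of_nat_diff)
      qed
      let ?so = "\<lambda>i. (xs @ [n, 0]) ! i"
      from r have "satisfies_rule I
        (Rule [objs (Srch f ?n) (?n # [0..<?n]), objs (Ev f (Suc ?n)) (?n # [0..<?n] @ [?n + 1]),
            num (?n + 1) (TConst 1)]
        (objs (Ev (Mn f) ?n) ([0..<?n] @ [?n])))" by (simp add: ball_Un)
      from satisfies_ruleD[OF this, of ?so "\<lambda>_. 0"]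
      show "(Ev (Mn f) (length xs), map GO xs @ [GO n]) \<in> I"
        using f[OF elim(1)] srch num by (auto simp: nth_append_Suc)
    qed
  qed
qed

section \<open>The reduction\<close>

definition inp :: "nat \<Rightarrow> atom" where
  "inp x = Atom Inp [TConst (- int x - 1)]"

definition name_fact :: "nat \<Rightarrow> int \<Rightarrow> atom" where
  "name_fact ob k = Atom Num [OConst ob, TConst k]"

text \<open>With all thresholds at 0, the input fact at its negative time is forgotten, while an
  update can use all positive times and hence name every number.\<close>

definition forget_instance :: "recf \<Rightarrow> nat \<Rightarrow> forget_instance" where
  "forget_instance g x = ((Goal, program g), [inp x], 0, 0, 0)"

lemma satisfies_fact_rule [simp]:
  "satisfies_rule I (fact_rule a) \<longleftrightarrow> (\<forall>so st. inst_atom so st a \<in> I)"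
  by (simp add: satisfies_rule_def fact_rule_def)

lemma temporal_atom_inp: "temporal_atom (inp x)"
  by (simp add: inp_def)

lemma not_rigid_inp: "\<not> rigid_atom (inp x)"
  by (simp add: inp_def rigid_atom_def rigid_pred_def Inp_def)

lemma valid_forget_instance: "valid_forget_instance (forget_instance g x)"
proof -
  have "Goal \<in> preds_of_program (program g)"
    by (auto simp: preds_of_program_def program_def)
  then show ?thesis
    using wf_program_program[of g] temporal_atom_inp[of x]
    by (auto simp: valid_forget_instance_def forget_instance_def temporal_query_def temporal_pred_def
        Goal_def is_history_def is_dataset_def is_fact_def ground_atom_def fact_time_def inp_def Inp_def)
qed

lemma restrict_inp: "restrict (set [inp x]) 0 = {}"
  using not_rigid_inp by (auto simp: restrict_def fact_time_def inp_def)

lemma ground_args: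
  assumes "well_sorted (Atom P ts)" "ground_atom (Atom P ts)"
  shows "psorts P = [TimeS] \<Longrightarrow> \<exists>k. ts = [TConst k]"
    and "psorts P = [ObjS, TimeS] \<Longrightarrow> \<exists>ob k. ts = [OConst ob, TConst k]"
proof -
  have t: "term_ground t \<Longrightarrow> term_sort t = TimeS \<Longrightarrow> \<exists>k. t = TConst k" for t by (cases t) auto
  have o: "term_ground t \<Longrightarrow> term_sort t = ObjS \<Longrightarrow> \<exists>k. t = OConst k" for t by (cases t) auto
  show "psorts P = [TimeS] \<Longrightarrow> \<exists>k. ts = [TConst k]"
    using assms t by (auto simp: well_sorted_def ground_atom_def map_eq_Cons_conv)
  show "psorts P = [ObjS, TimeS] \<Longrightarrow> \<exists>ob k. ts = [OConst ob, TConst k]"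
    using assms t o by (auto simp: well_sorted_def ground_atom_def map_eq_Cons_conv)
qed

text \<open>Naming facts hold by the choice of \<open>v\<close>, \<open>Inp\<close> facts of an
  update lie at positive times, where the model admits them, and the model puts no condition on
  other EDB predicates.\<close>

lemma model_update:
  assumes U: "is_update 0 U" and a: "a \<in> set U"
    and v: "\<And>ob k. name_fact ob k \<in> set U \<Longrightarrow> k = int (v ob) + 1"
  shows "inst_atom so st a \<in> model v X g"
proof (cases a)
  case (Atom P ts)
  have wf: "well_sorted (Atom P ts)" "ground_atom (Atom P ts)" "is_edb P" "0 < fact_time (Atom P ts)"
    using U a Atom by (auto simp: is_update_def is_dataset_def is_fact_def temporal_atom_def)
  consider "P = Num" | "P = Inp" | "P \<noteq> Num" "P \<noteq> Inp" by blast
  then show ?thesis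
  proof cases
    case 1
    then show ?thesis
      using ground_args(2)[OF wf(1,2)] v a Atom by (auto simp: Num_def[THEN arg_cong, of psorts] name_fact_def)
  next
    case 2
    then show ?thesis
      using ground_args(1)[OF wf(1,2)] wf(4) Atom by (auto simp: Inp_def[THEN arg_cong, of psorts] fact_time_def)
  next
    case 3
    then show ?thesis
      using wf(3) Atom by (auto simp: model_def) (auto simp: Ev_def Srch_def)
  qed
qed

lemma model_inp: "x \<in> X \<Longrightarrow> inst_atom so st (inp x) \<in> model v X g"
  by (auto simp: inp_def)

lemma update_time_pos: "is_update 0 U \<Longrightarrow> name_fact ob k \<in> set U \<Longrightarrow> 0 < k"
  by (fastforce simp: is_update_def fact_time_def name_fact_def)

lemma answers_mono: "F \<subseteq> F' \<Longrightarrow> answers Q F \<tau> \<subseteq> answers Q F' \<tau>"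
  using image_mono[of F F' fact_rule] unfolding answers_def entails_def by blast

lemma head_compile: "r \<in> set (compile f n) \<Longrightarrow> apred (head r) \<noteq> Goal"
  by (induction f n arbitrary: r rule: compile.induct)
    (auto simp: objs_def split: if_splits nat.splits)

text \<open>Forget compares all answers from time 0 on; this reduces them to the empty tuple at time
  0. The interpretation \<open>?I\<close> omits only the \<open>Goal\<close> atoms other than the
  one at time 0, and every rule for \<open>Goal\<close> has exactly that head.\<close>

lemma answers_programD:
  assumes "\<forall>a\<in>F. is_edb (apred a)" and "os \<in> answers (Goal, program g) F \<tau>"
  shows "os = []" "\<tau> = 0"
proof -
  let ?I = "{(P, vs). P = Goal \<longrightarrow> vs = [GT 0]} :: gatom set"
  have "satisfies_rule ?I r" if "r \<in> set (program g)" for r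
  proof (cases "apred (head r) = Goal")
    case False
    then show ?thesis by (auto simp: satisfies_rule_def inst_atom_def)
  next
    case True
    then show ?thesis
      using that by (auto simp: program_def satisfies_rule_def dest: head_compile)
  qed
  moreover have "satisfies_rule ?I (fact_rule a)" if "a \<in> F" for a
    using assms(1) that by (auto simp: inst_atom_def)
  ultimately have "\<forall>r\<in>set (program g) \<union> fact_rule ` F. satisfies_rule ?I r" by blast
  moreover have "entails (set (program g) \<union> fact_rule ` F) (Goal, map GO os @ [GT \<tau>])"
    using assms(2) by (simp add: answers_def)
  ultimately have "(Goal, map GO os @ [GT \<tau>]) \<in> ?I" unfolding entails_def by blast
  then show "os = []" "\<tau> = 0" by (auto simp: append_eq_Cons_conv)
qed

text \<open>\<open>Later\<close> spreads upwards from \<open>k + 1\<close> in unit steps until it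
  meets \<open>k'\<close>. No input fact is involved, so an update alone can achieve this.\<close>

lemma entails_Goal_ambiguous:
  assumes "name_fact ob k \<in> F" "name_fact ob k' \<in> F" "k < k'"
  shows "entails (set (program g) \<union> fact_rule ` F) (Goal, [GT 0])"
  unfolding entails_def
proof (intro allI impI)
  fix I assume I: "\<forall>r\<in>set (program g) \<union> fact_rule ` F. satisfies_rule I r"
  have "satisfies_rule I (fact_rule (name_fact ob k))"
    "satisfies_rule I (fact_rule (name_fact ob k'))"
    using I assms(1,2) by blast+
  then have k: "(Num, [GO ob, GT k]) \<in> I" and k': "(Num, [GO ob, GT k']) \<in> I"
    by (auto simp: name_fact_def)
  have "satisfies_rule I (Rule [num 0 (TVar 0)] (Atom Later [OVar 0, TPlus 0 1]))"
    using I by (simp add: program_def)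
  from satisfies_ruleD[OF this, of "\<lambda>_. ob" "\<lambda>_. k"] k
  have "(Later, [GO ob, GT (k + 1)]) \<in> I" by simp
  have later_step: "satisfies_rule I (Rule [Atom Later [OVar 0, TVar 0]] (Atom Later [OVar 0, TPlus 0 1]))"
    using I by (simp add: program_def)
  have "k + 1 \<le> k'" using assms(3) by simp
  then have later: "(Later, [GO ob, GT k']) \<in> I"
  proof (induction k' rule: int_ge_induct)
    case base
    show ?case by fact
  next
    case (step i)
    then show ?case
      using satisfies_ruleD[OF later_step, of "\<lambda>_. ob" "\<lambda>_. i"] by simp
  qed
  have "satisfies_rule I (Rule [Atom Later [OVar 0, TVar 0], num 0 (TVar 0)] (Atom Goal [TConst 0]))"
    using I by (simp add: program_def)
  from satisfies_ruleD[OF this, of "\<lambda>_. ob" "\<lambda>_. k'"] k' later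
  show "(Goal, [GT 0]) \<in> I" by simp
qed

lemma entails_Goal_eval:
  assumes "eval g [x] 1"
  obtains N where "entails (set (program g) \<union>
    fact_rule ` insert (inp x) ((\<lambda>i. name_fact i (int i + 1)) ` {..N})) (Goal, [GT 0])"
proof -
  \<comment> \<open>Besides the computation, the input must be named for counting up to it, and 1
    for the test of the output.\<close>
  have "\<forall>\<^sub>F N in sequentially. derived g [x] 1 N \<and> x \<le> N \<and> 1 \<le> N"
    using eval_imp_eventually_derived[OF assms] eventually_ge_at_top[of x]
      eventually_ge_at_top[of "1::nat"] by eventually_elim simp
  then obtain N where N: "derived g [x] 1 N" "x \<le> N" "1 \<le> N"
    by (auto simp: eventually_sequentially)
  show thesis
  proof (rule that[of N], unfold entails_def, intro allI impI)
    fix I assume I: "\<forall>r\<in>set (program g) \<union>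
      fact_rule ` insert (inp x) ((\<lambda>i. name_fact i (int i + 1)) ` {..N}). satisfies_rule I r"
    have num: "\<forall>i\<le>N. (Num, [GO i, GT (int i + 1)]) \<in> I"
      using I by (auto simp: name_fact_def ball_Un)
    have inp: "(Inp, [GT (- int x - 1)]) \<in> I"
      using I by (auto simp: inp_def ball_Un)
    have "\<forall>r\<in>set (compile g 1). satisfies_rule I r" using I by (simp add: program_def)
    with N(1) num have ev: "(Ev g 1, [GO x, GO 1]) \<in> I" by (simp add: derived_def)
    have count0: "satisfies_rule I
        (Rule [Atom Inp [TVar 0], num 0 (TConst 1)] (Atom Count [OVar 0, TVar 0]))"
      and countS: "satisfies_rule I
        (Rule [Atom Count [OVar 0, TVar 0], num 0 (TVar 1), num 1 (TPlus 1 1)]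
        (Atom Count [OVar 1, TPlus 0 1]))"
      and goal: "satisfies_rule I
        (Rule [Atom Count [OVar 0, TConst (- 1)], objs (Ev g 1) [0, 1], num 1 (TConst 2)]
        (Atom Goal [TConst 0]))"
      using I by (simp_all add: program_def)
    \<comment> \<open>Number \<open>i\<close> is reached at time \<open>i - x - 1\<close>, so
      \<open>x\<close> is reached at time - 1.\<close>
    have "i \<le> N \<Longrightarrow> (Count, [GO i, GT (int i - int x - 1)]) \<in> I" for i
    proof (induction i)
      case 0
      show ?case
        using satisfies_ruleD[OF count0, of "\<lambda>_. 0" "\<lambda>_. - int x - 1"] inp
          num[rule_format, of 0] by simp
    next
      case (Suc i)
      then show ?case
        using satisfies_ruleD[OF countS, of "\<lambda>j. i + j" "\<lambda>j. if j = 0 then int i - int x - 1 else int i + 1"]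
          num[rule_format, of i] num[rule_format, of "Suc i"]
        by (simp add: algebra_simps)
    qed
    from this[OF N(2)] have "(Count, [GO x, GT (- 1)]) \<in> I" by simp
    then show "(Goal, [GT 0]) \<in> I"
      using satisfies_ruleD[OF goal, of "\<lambda>j. if j = 0 then x else 1" "\<lambda>_. 0"] ev
        num[rule_format, OF N(3)] by simp
  qed
qed

text \<open>Used with \<open>X = {x}\<close> when the history is present, and with
  \<open>X = {}\<close> for an update alone, where it refutes the goal.\<close>

lemma entails_GoalD:
  assumes "entails (set (program g) \<union> fact_rule ` F) (Goal, vs)"
    and "\<And>a so st. a \<in> F \<Longrightarrow> inst_atom so st a \<in> model v X g"
  shows "\<exists>x\<in>X. eval g [x] 1"
proof -
  have "\<forall>r\<in>set (program g) \<union> fact_rule ` F. satisfies_rule (model v X g) r"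
    using assms(2) by (auto intro: model_program)
  with assms(1) have "(Goal, vs) \<in> model v X g" unfolding entails_def by blast
  then show ?thesis by simp
qed

lemma forget_holds_iff: "forget_holds (forget_instance g x) \<longleftrightarrow> \<not> eval g [x] 1"
proof
  assume no: "\<not> eval g [x] 1"
  have "answers (Goal, program g) (insert (inp x) (set U)) \<tau> \<subseteq> answers (Goal, program g) (set U) \<tau>"
    if U: "is_update 0 U" for U \<tau>
  proof
    fix os assume os: "os \<in> answers (Goal, program g) (insert (inp x) (set U)) \<tau>"
    have edb: "\<forall>a\<in>insert (inp x) (set U). is_edb (apred a)"
      using U by (auto simp: is_update_def is_dataset_def inp_def Inp_def)
    note os' = answers_programD[OF edb os]
    \<comment> \<open>Unambiguous names would give a model in which the goal is false.\<close>
    have "\<exists>ob k k'. name_fact ob k \<in> set U \<and> name_fact ob k' \<in> set U \<and> k < k'"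
    proof (rule ccontr)
      assume "\<not> ?thesis"
      then have unique: "k = k'" if "name_fact ob k \<in> set U" "name_fact ob k' \<in> set U" for ob k k'
        using that linorder_less_linear[of k k'] by blast
      \<comment> \<open>This undoes the shift by 1; \<open>nat\<close> loses nothing since update
        times are positive. Objects without a name get an unspecified number, which no naming fact
        constrains.\<close>
      define v where "v ob = nat ((THE k. name_fact ob k \<in> set U) - 1)" for ob
      have v: "k = int (v ob) + 1" if "name_fact ob k \<in> set U" for ob k
      proof -
        have "(THE k. name_fact ob k \<in> set U) = k"
          using that by (rule the_equality) (rule unique[OF _ that])
        with update_time_pos[OF U that] show ?thesis by (simp add: v_def)
      qed
      have "inst_atom so st a \<in> model v {x} g" if "a \<in> insert (inp x) (set U)" for a so st
        using that
      proof
        assume "a \<in> set U"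
        then show ?thesis by (rule model_update[OF U _ v])
      qed (simp add: model_inp)
      moreover have "entails (set (program g) \<union> fact_rule ` insert (inp x) (set U))
          (Goal, map GO os @ [GT \<tau>])"
        using os by (simp add: answers_def)
      ultimately have "\<exists>x\<in>{x}. eval g [x] 1" by (intro entails_GoalD[where v = v])
      with no show False by blast
    qed
    then have "entails (set (program g) \<union> fact_rule ` set U) (Goal, [GT 0])"
      using entails_Goal_ambiguous by blast
    then show "os \<in> answers (Goal, program g) (set U) \<tau>"
      using os' by (simp add: answers_def)
  qed
  moreover have "answers (Goal, program g) (set U) \<tau> \<subseteq> answers (Goal, program g) (insert (inp x) (set U)) \<tau>"
    for U \<tau>
    by (rule answers_mono) auto
  ultimately have "answers (Goal, program g) (insert (inp x) (set U)) \<tau> =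
      answers (Goal, program g) (set U) \<tau>" if "is_update 0 U" for U \<tau>
    using that by (meson subset_antisym)
  then show "forget_holds (forget_instance g x)"
    using restrict_inp[of x] by (simp add: forget_holds_def forget_instance_def)
next
  assume holds: "forget_holds (forget_instance g x)"
  show "\<not> eval g [x] 1"
  proof
    assume "eval g [x] 1"
    then obtain N where N: "entails (set (program g) \<union>
      fact_rule ` insert (inp x) ((\<lambda>i. name_fact i (int i + 1)) ` {..N})) (Goal, [GT 0])"
      by (rule entails_Goal_eval)
    \<comment> \<open>The canonical names up to \<open>N\<close> separate the two sides: with the
      input they yield the goal, without it the model for \<open>X = {}\<close> refutes the
      goal.\<close>
    define U where "U = map (\<lambda>i. name_fact i (int i + 1)) [0..<Suc N]"
    have setU: "set U = (\<lambda>i. name_fact i (int i + 1)) ` {..N}"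
      by (auto simp: U_def simp del: upt_Suc)
    have U: "is_update 0 U"
      by (auto simp: is_update_def setU name_fact_def is_dataset_def is_fact_def ground_atom_def
          temporal_atom_def temporal_pred_def well_sorted_def Num_def fact_time_def)
    have "[] \<in> answers (Goal, program g) (insert (inp x) (set U)) 0"
      using N by (simp add: answers_def setU)
    moreover have "answers (Goal, program g) (insert (inp x) (set U)) 0 =
      answers (Goal, program g) (set U) 0"
      using holds U restrict_inp[of x] by (simp add: forget_holds_def forget_instance_def)
    ultimately have "[] \<in> answers (Goal, program g) (set U) 0" by blast
    then have "entails (set (program g) \<union> fact_rule ` set U) (Goal, [GT 0])"
      by (simp add: answers_def)
    moreover have "inst_atom so st a \<in> model (\<lambda>i. i) {} g" if "a \<in> set U" for a so st
    proof (rule model_update[OF U that])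
      fix ob k
      assume "name_fact ob k \<in> set U"
      then show "k = int ob + 1" by (auto simp: setU name_fact_def)
    qed
    ultimately show False using entails_GoalD[of g "set U" _ "\<lambda>i. i" "{}"] by blast
  qed
qed

section \<open>Computing the code of an instance, and the diagonal argument\<close>

lemma int_encode_inp: "int_encode (- int x - 1) = Suc (2 * x)"
  by (simp add: int_encode_def sum_encode_def)

text \<open>The number \<open>x\<close> serves both as the code of the program and, through
  \<open>inp x\<close>, as the input. The time \<open>- x - 1\<close> has the code
  \<open>2 * x + 1\<close>, so addition and list coding suffice.\<close>

lemma unary_rec_enc_instance:
  "unary_rec (\<lambda>x. list_encode [a, x, list_encode [enc_atom (inp x)], b, c, d])"
proof -
  have "unary_rec (\<lambda>x. Suc (x + x))" by (intro unary_rec_Suc unary_rec_add unary_rec_id)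
  then have "unary_rec (\<lambda>x. enc_atom (inp x))"
    unfolding enc_atom_def inp_def
    by (simp add: int_encode_inp mult_2 del: list_encode.simps)
       (intro unary_rec_list_encode_Cons unary_rec_list_encode_Nil unary_rec_const)
  then show ?thesis
    by (intro unary_rec_list_encode_Cons unary_rec_list_encode_Nil unary_rec_const unary_rec_id)
qed

theorem theorem7:
  shows "\<not> decidable_on enc_instance valid_forget_instance forget_holds"
proof
  assume "decidable_on enc_instance valid_forget_instance forget_holds"
  then obtain f where f: "valid_forget_instance i \<Longrightarrow>
      eval f [enc_instance i] (if forget_holds i then 1 else 0)" for i
    unfolding decidable_on_def by blast
  obtain s where s: "\<And>x. eval s [x] (list_encode [enc_pred Goal, x, list_encode [enc_atom (inp x)],
      int_encode 0, int_encode 0, int_encode 0])"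
    using unary_rec_enc_instance unfolding unary_rec_def by blast
  define g where "g = Comp f [s]"
  define x where "x = list_encode (map enc_rule (program g))"
  \<comment> \<open>As \<open>x\<close> codes the program for \<open>g\<close>, the instance built
    by \<open>s\<close> is the one for \<open>g\<close> itself.\<close>
  have "eval s [x] (enc_instance (forget_instance g x))"
    using s[of x] by (simp add: enc_instance_def forget_instance_def x_def del: list_encode.simps)
  then have "eval g [x] (if forget_holds (forget_instance g x) then 1 else 0)"
    unfolding g_def using f[OF valid_forget_instance] by (rule eval_Comp1)
  \<comment> \<open>\<open>g\<close> yields 1 at \<open>x\<close> iff Forget holds for the instance,
    that is, iff \<open>g\<close> does not yield 1 at \<open>x\<close>.\<close>
  then show False
    using forget_holds_iff[of g x] eval_deterministic[of g "[x]" 0 1] by (auto split: if_splits)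
qed

end
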